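(* Let $\mathcal{M}_{\pm}$ be a quantum Markov category and $\mathcal{M}$ its subcategory of even morphisms. Let $p:I\to X$ be a state in $\mathcal{M}$, let $f:X\to Y$ be a morphism in $\mathcal{M}$ that is either left or right $p$-a.e. deterministic, and set $q:=f\circ p$. If $g:Y\to X$ is a left (respectively, right) Bayes map in $\mathcal{M}$ for $(f,p,q)$, then $g$ is a left (respectively, right) disintegration of $(f,p,q)$ in $\mathcal{M}$. In particular, if all morphisms are $*$-preserving, then all adjectives "left" and "right" may be dropped.
   Context: A $\mathbb{Z}_2$-monoidal category is a category in which every morphism has a grade in $\mathbb{Z}_2=\{0,1\}$ ($0$ = even, $1$ = odd), identities being even and grades adding under composition, such that for each object $X$ and each grade there is an isomorphism with source $X$ of that grade; together with a tensor product assigning $X\otimes Y$ to objects and $f\otimes f'$ (of the common grade) to pairs of morphisms of equal grade, functorially; a unit object $I$ with a chosen odd involution $*_I$ of $I$; and even natural isomorphisms (associator, symmetry $c_{X,Y}:X\otimes Y\to Y\otimes X$, unitor $I\otimes X\to X$) satisfying the usual axioms of a symmetric monoidal category. Associators and unitors are suppressed. A quantum CD category is a $\mathbb{Z}_2$-monoidal category with, for each object $X$, even morphisms $\Delta_X:X\to X\otimes X$, $!_X:X\to I$ and an odd morphism $*_X:X\to X$ such that: $(!_X\otimes\mathrm{id})\Delta_X=\mathrm{id}_X=(\mathrm{id}\otimes{!_X})\Delta_X$; $(\Delta_X\otimes\mathrm{id})\Delta_X=(\mathrm{id}\otimes\Delta_X)\Delta_X$; $c_{X,X}( *_X\otimes*_X)\Delta_X=\Delta_X*_X$;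 $!_{X\otimes Y}={!_X}\otimes{!_Y}$; $!_I=\mathrm{id}_I$; $\Delta_{X\otimes Y}=(\mathrm{id}_X\otimes c_{X,Y}\otimes\mathrm{id}_Y)(\Delta_X\otimes\Delta_Y)$; $\Delta_I=\mathrm{id}_I$; $*_X*_X=\mathrm{id}_X$; $*_{X\otimes Y}=*_X\otimes*_Y$; $!_X*_X=*_I\,!_X$. It is a quantum Markov category if moreover every even $f:X\to Y$ satisfies $!_Y f={!_X}$ and every odd $f:X\to Y$ satisfies $!_Yf={!_X}*_X$. A morphism $f:X\to Y$ is $*$-preserving if $f*_X=*_Yf$. A state on $X$ is a morphism $I\to X$. For $p:\Theta\to X$ and an even $f:X\to Y$: $f$ is left $p$-a.e. deterministic if $(f\otimes f\otimes\mathrm{id}_X)(\Delta_X\otimes\mathrm{id}_X)\Delta_Xp=((\Delta_Yf)\otimes\mathrm{id}_X)\Delta_Xp$, and right $p$-a.e. deterministic if $(\mathrm{id}_X\otimes f\otimes f)(\mathrm{id}_X\otimes\Delta_X)\Delta_Xp=(\mathrm{id}_X\otimes(\Delta_Yf))\Delta_Xp$. Given states $p:I\to X$, $q:I\to Y$ and $f:X\to Y$ with $fp=q$: a left Bayes map for $(f,p,q)$ is an even $g:Y\to X$ with $(g\otimes\mathrm{id}_Y)\Delta_Yq=(\mathrm{id}_X\otimes f)\Delta_Xp$; a right Bayes map satisfies $(\mathrm{id}_Y\otimes g)\Delta_Yq=(f\otimes\mathrm{id}_X)\Delta_Xp$. A left disintegration of $(f,p,q)$ in $\mathcal{M}$ is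 an even $g:Y\to X$ with $gq=p$ and $((fg)\otimes\mathrm{id}_Y)\Delta_Yq=\Delta_Yq$; a right disintegration satisfies $gq=p$ and $(\mathrm{id}_Y\otimes(fg))\Delta_Yq=\Delta_Yq$. *)

theory Defs
  imports "HOL-Library.Z2"
begin

text \<open>
  Categories are given by a set of objects, a set of arrows, and operations that are only
  meaningful on these carriers. The structure is not assumed strict: associators and unitors are
  written out wherever informal notation suppresses them. Grades live in the two-element
  field \<^typ>\<open>bit\<close>, whose addition is addition modulo 2.
\<close>

record ('o, 'a) graded_category =
  obj :: "'o set"
  arr :: "'a set"
  src :: "'a \<Rightarrow> 'o"
  tgt :: "'a \<Rightarrow> 'o"
  idn :: "'o \<Rightarrow> 'a"  ("\<one>\<index>")
  cmp :: "'a \<Rightarrow> 'a \<Rightarrow> 'a"  (infixr "\<cdot>\<index>" 55)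
  grade :: "'a \<Rightarrow> bit"

definition hom :: "('o, 'a, 'm) graded_category_scheme \<Rightarrow> 'o \<Rightarrow> 'o \<Rightarrow> 'a set"
  where "hom C X Y = {f \<in> arr C. src C f = X \<and> tgt C f = Y}"

definition graded_hom ::
    "('o, 'a, 'm) graded_category_scheme \<Rightarrow> bit \<Rightarrow> 'o \<Rightarrow> 'o \<Rightarrow> 'a set"
  where "graded_hom C i X Y = {f \<in> hom C X Y. grade C f = i}"

text \<open>The hom-sets of the subcategory of even morphisms.\<close>

abbreviation even_hom :: "('o, 'a, 'm) graded_category_scheme \<Rightarrow> 'o \<Rightarrow> 'o \<Rightarrow> 'a set"
  where "even_hom C \<equiv> graded_hom C 0"

abbreviation odd_hom :: "('o, 'a, 'm) graded_category_scheme \<Rightarrow> 'o \<Rightarrow> 'o \<Rightarrow> 'a set"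
  where "odd_hom C \<equiv> graded_hom C 1"

definition inverse_arrows :: "('o, 'a, 'm) graded_category_scheme \<Rightarrow> 'a \<Rightarrow> 'a \<Rightarrow> bool"
  where "inverse_arrows C f g \<longleftrightarrow>
    f \<in> arr C \<and> g \<in> hom C (tgt C f) (src C f) \<and>
    g \<cdot> f = \<one> (src C f) \<and> f \<cdot> g = \<one> (tgt C f)"
  for C (structure)

definition iso :: "('o, 'a, 'm) graded_category_scheme \<Rightarrow> 'a \<Rightarrow> bool"
  where "iso C f \<longleftrightarrow> (\<exists>g. inverse_arrows C f g)"

definition inv_arr :: "('o, 'a, 'm) graded_category_scheme \<Rightarrow> 'a \<Rightarrow> 'a"
  where "inv_arr C f = (THE g. inverse_arrows C f g)"

locale graded_category =
  fixes C :: "('o, 'a, 'm) graded_category_scheme" (structure)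
  assumes src_obj: "f \<in> arr C \<Longrightarrow> src C f \<in> obj C"
    and tgt_obj: "f \<in> arr C \<Longrightarrow> tgt C f \<in> obj C"
    and idn_hom: "X \<in> obj C \<Longrightarrow> \<one> X \<in> even_hom C X X"
    and cmp_hom: "\<lbrakk>f \<in> graded_hom C i X Y; g \<in> graded_hom C j Y Z\<rbrakk>
      \<Longrightarrow> g \<cdot> f \<in> graded_hom C (i + j) X Z"
    and idn_left: "f \<in> hom C X Y \<Longrightarrow> \<one> Y \<cdot> f = f"
    and idn_right: "f \<in> hom C X Y \<Longrightarrow> f \<cdot> \<one> X = f"
    and cmp_assoc: "\<lbrakk>f \<in> hom C W X; g \<in> hom C X Y; h \<in> hom C Y Z\<rbrakk>
      \<Longrightarrow> (h \<cdot> g) \<cdot> f = h \<cdot> (g \<cdot> f)"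
    and iso_of_grade: "X \<in> obj C \<Longrightarrow> \<exists>f \<in> arr C. src C f = X \<and> grade C f = i \<and> iso C f"

text \<open>
  The arrow part of the tensor product is only constrained on pairs of equal grade.
  The associator goes from \<open>(X \<odot> Y) \<odot> Z\<close> to \<open>X \<odot> (Y \<odot> Z)\<close>.
\<close>

record ('o, 'a) z2_monoidal_category = "('o, 'a) graded_category" +
  tensor_obj :: "'o \<Rightarrow> 'o \<Rightarrow> 'o"  (infix "\<odot>\<index>" 65)
  tensor_arr :: "'a \<Rightarrow> 'a \<Rightarrow> 'a"  (infix "\<otimes>\<index>" 65)
  unit :: "'o"  ("\<I>\<index>")
  unit_star :: "'a"
  associator :: "'o \<Rightarrow> 'o \<Rightarrow> 'o \<Rightarrow> 'a"  ("\<alpha>\<index>")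
  symmetry :: "'o \<Rightarrow> 'o \<Rightarrow> 'a"  ("\<gamma>\<index>")
  left_unitor :: "'o \<Rightarrow> 'a"  ("\<l>\<index>")

definition right_unitor :: "('o, 'a, 'm) z2_monoidal_category_scheme \<Rightarrow> 'o \<Rightarrow> 'a"
    ("\<r>\<index>")
  where "\<r>\<^bsub>C\<^esub> X = \<l> X \<cdot> \<gamma> X \<I>"
  for C (structure)

text \<open>
  The unit object is acted on by both grades: \<open>unit_arr C i\<close> is the chosen automorphism of the
  unit of grade \<open>i\<close>. The functor that tensors with the unit sends a morphism \<open>f\<close> of grade \<open>i\<close>
  to \<open>unit_arr C i \<otimes> f\<close>, and it is with respect to this functor that the left unitor is
  natural.
\<close>

definition unit_arr :: "('o, 'a, 'm) z2_monoidal_category_scheme \<Rightarrow> bit \<Rightarrow> 'a"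
  where "unit_arr C i = (if i = 0 then \<one> \<I> else unit_star C)"
  for C (structure)

locale z2_monoidal_category = graded_category C
  for C :: "('o, 'a, 'm) z2_monoidal_category_scheme" (structure) +
  assumes tensor_obj_closed: "\<lbrakk>X \<in> obj C; Y \<in> obj C\<rbrakk> \<Longrightarrow> X \<odot> Y \<in> obj C"
    and tensor_hom: "\<lbrakk>f \<in> graded_hom C i X Y; f' \<in> graded_hom C i X' Y'\<rbrakk>
      \<Longrightarrow> f \<otimes> f' \<in> graded_hom C i (X \<odot> X') (Y \<odot> Y')"
    and tensor_idn: "\<lbrakk>X \<in> obj C; Y \<in> obj C\<rbrakk> \<Longrightarrow> \<one> X \<otimes> \<one> Y = \<one> (X \<odot> Y)"
    and tensor_cmp: "\<lbrakk>f \<in> graded_hom C i X Y; f' \<in> graded_hom C i X' Y';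
        g \<in> graded_hom C j Y Z; g' \<in> graded_hom C j Y' Z'\<rbrakk>
      \<Longrightarrow> (g \<cdot> f) \<otimes> (g' \<cdot> f') = (g \<otimes> g') \<cdot> (f \<otimes> f')"
    and unit_obj: "\<I> \<in> obj C"
    and unit_star_hom: "unit_star C \<in> odd_hom C \<I> \<I>"
    and unit_star_involution: "unit_star C \<cdot> unit_star C = \<one> \<I>"
    and associator_hom: "\<lbrakk>X \<in> obj C; Y \<in> obj C; Z \<in> obj C\<rbrakk>
      \<Longrightarrow> \<alpha> X Y Z \<in> even_hom C ((X \<odot> Y) \<odot> Z) (X \<odot> (Y \<odot> Z))"
    and associator_iso: "\<lbrakk>X \<in> obj C; Y \<in> obj C; Z \<in> obj C\<rbrakk> \<Longrightarrow> iso C (\<alpha> X Y Z)"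
    and associator_natural: "\<lbrakk>f \<in> graded_hom C i X X'; g \<in> graded_hom C i Y Y';
        h \<in> graded_hom C i Z Z'\<rbrakk>
      \<Longrightarrow> \<alpha> X' Y' Z' \<cdot> ((f \<otimes> g) \<otimes> h) = (f \<otimes> (g \<otimes> h)) \<cdot> \<alpha> X Y Z"
    and symmetry_hom: "\<lbrakk>X \<in> obj C; Y \<in> obj C\<rbrakk>
      \<Longrightarrow> \<gamma> X Y \<in> even_hom C (X \<odot> Y) (Y \<odot> X)"
    and symmetry_inverse: "\<lbrakk>X \<in> obj C; Y \<in> obj C\<rbrakk> \<Longrightarrow> \<gamma> Y X \<cdot> \<gamma> X Y = \<one> (X \<odot> Y)"
    and symmetry_natural: "\<lbrakk>f \<in> graded_hom C i X X'; g \<in> graded_hom C i Y Y'\<rbrakk>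
      \<Longrightarrow> \<gamma> X' Y' \<cdot> (f \<otimes> g) = (g \<otimes> f) \<cdot> \<gamma> X Y"
    and left_unitor_hom: "X \<in> obj C \<Longrightarrow> \<l> X \<in> even_hom C (\<I> \<odot> X) X"
    and left_unitor_iso: "X \<in> obj C \<Longrightarrow> iso C (\<l> X)"
    and left_unitor_natural: "f \<in> graded_hom C i X Y
      \<Longrightarrow> \<l> Y \<cdot> (unit_arr C i \<otimes> f) = f \<cdot> \<l> X"
    and pentagon: "\<lbrakk>W \<in> obj C; X \<in> obj C; Y \<in> obj C; Z \<in> obj C\<rbrakk>
      \<Longrightarrow> \<alpha> W X (Y \<odot> Z) \<cdot> \<alpha> (W \<odot> X) Y Z =
          (\<one> W \<otimes> \<alpha> X Y Z) \<cdot> \<alpha> W (X \<odot> Y) Z \<cdot> (\<alpha> W X Y \<otimes> \<one> Z)"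
    and triangle: "\<lbrakk>X \<in> obj C; Y \<in> obj C\<rbrakk>
      \<Longrightarrow> (\<one> X \<otimes> \<l> Y) \<cdot> \<alpha> X \<I> Y = \<r> X \<otimes> \<one> Y"
    and hexagon: "\<lbrakk>X \<in> obj C; Y \<in> obj C; Z \<in> obj C\<rbrakk>
      \<Longrightarrow> \<alpha> Y Z X \<cdot> \<gamma> X (Y \<odot> Z) \<cdot> \<alpha> X Y Z =
          (\<one> Y \<otimes> \<gamma> X Z) \<cdot> \<alpha> Y X Z \<cdot> (\<gamma> X Y \<otimes> \<one> Z)"

text \<open>
  The morphism \<open>id\<^sub>X \<otimes> c\<^sub>X\<^sub>,\<^sub>Y \<otimes> id\<^sub>Y\<close> from \<open>(X \<odot> X) \<odot> (Y \<odot> Y)\<close> to \<open>(X \<odot> Y) \<odot> (X \<odot> Y)\<close>,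
  with its associators.
\<close>

definition middle_swap :: "('o, 'a, 'm) z2_monoidal_category_scheme \<Rightarrow> 'o \<Rightarrow> 'o \<Rightarrow> 'a"
  where "middle_swap C X Y =
    inv_arr C (\<alpha> X Y (X \<odot> Y)) \<cdot> (\<one> X \<otimes> \<alpha> Y X Y) \<cdot> (\<one> X \<otimes> (\<gamma> X Y \<otimes> \<one> Y)) \<cdot>
    (\<one> X \<otimes> inv_arr C (\<alpha> X Y Y)) \<cdot> \<alpha> X X (Y \<odot> Y)"
  for C (structure)

record ('o, 'a) quantum_cd_category = "('o, 'a) z2_monoidal_category" +
  copy :: "'o \<Rightarrow> 'a"  ("\<Delta>\<index>")
  discard :: "'o \<Rightarrow> 'a"  ("\<epsilon>\<index>")
  star :: "'o \<Rightarrow> 'a"  ("\<star>\<index>")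

locale quantum_cd_category = z2_monoidal_category C
  for C :: "('o, 'a, 'm) quantum_cd_category_scheme" (structure) +
  assumes copy_hom: "X \<in> obj C \<Longrightarrow> \<Delta> X \<in> even_hom C X (X \<odot> X)"
    and discard_hom: "X \<in> obj C \<Longrightarrow> \<epsilon> X \<in> even_hom C X \<I>"
    and star_hom: "X \<in> obj C \<Longrightarrow> \<star> X \<in> odd_hom C X X"
    and star_unit: "\<star> \<I> = unit_star C"
    and discard_left: "X \<in> obj C \<Longrightarrow> \<l> X \<cdot> (\<epsilon> X \<otimes> \<one> X) \<cdot> \<Delta> X = \<one> X"
    and discard_right: "X \<in> obj C \<Longrightarrow> \<r> X \<cdot> (\<one> X \<otimes> \<epsilon> X) \<cdot> \<Delta> X = \<one> X"
    and copy_coassoc: "X \<in> obj C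
      \<Longrightarrow> \<alpha> X X X \<cdot> (\<Delta> X \<otimes> \<one> X) \<cdot> \<Delta> X = (\<one> X \<otimes> \<Delta> X) \<cdot> \<Delta> X"
    and copy_star: "X \<in> obj C \<Longrightarrow> \<gamma> X X \<cdot> (\<star> X \<otimes> \<star> X) \<cdot> \<Delta> X = \<Delta> X \<cdot> \<star> X"
    and discard_tensor: "\<lbrakk>X \<in> obj C; Y \<in> obj C\<rbrakk>
      \<Longrightarrow> \<epsilon> (X \<odot> Y) = \<l> \<I> \<cdot> (\<epsilon> X \<otimes> \<epsilon> Y)"
    and discard_unit: "\<epsilon> \<I> = \<one> \<I>"
    and copy_tensor: "\<lbrakk>X \<in> obj C; Y \<in> obj C\<rbrakk>
      \<Longrightarrow> \<Delta> (X \<odot> Y) = middle_swap C X Y \<cdot> (\<Delta> X \<otimes> \<Delta> Y)"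
    and copy_unit: "\<l> \<I> \<cdot> \<Delta> \<I> = \<one> \<I>"
    and star_involution: "X \<in> obj C \<Longrightarrow> \<star> X \<cdot> \<star> X = \<one> X"
    and star_tensor: "\<lbrakk>X \<in> obj C; Y \<in> obj C\<rbrakk> \<Longrightarrow> \<star> (X \<odot> Y) = \<star> X \<otimes> \<star> Y"
    and discard_star: "X \<in> obj C \<Longrightarrow> \<epsilon> X \<cdot> \<star> X = \<star> \<I> \<cdot> \<epsilon> X"

locale quantum_markov_category = quantum_cd_category C
  for C :: "('o, 'a, 'm) quantum_cd_category_scheme" (structure) +
  assumes discard_even: "f \<in> even_hom C X Y \<Longrightarrow> \<epsilon> Y \<cdot> f = \<epsilon> X"
    and discard_odd: "f \<in> odd_hom C X Y \<Longrightarrow> \<epsilon> Y \<cdot> f = \<epsilon> X \<cdot> \<star> X"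

definition star_preserving ::
    "('o, 'a, 'm) quantum_cd_category_scheme \<Rightarrow> 'o \<Rightarrow> 'o \<Rightarrow> 'a \<Rightarrow> bool"
  where "star_preserving C X Y f \<longleftrightarrow> f \<in> hom C X Y \<and> f \<cdot> \<star> X = \<star> Y \<cdot> f"
  for C (structure)

definition left_ae_deterministic ::
    "('o, 'a, 'm) quantum_cd_category_scheme \<Rightarrow> 'o \<Rightarrow> 'o \<Rightarrow> 'o \<Rightarrow> 'a \<Rightarrow> 'a \<Rightarrow> bool"
  where "left_ae_deterministic C T X Y p f \<longleftrightarrow>
    p \<in> hom C T X \<and> f \<in> even_hom C X Y \<and>
    ((f \<otimes> f) \<otimes> \<one> X) \<cdot> (\<Delta> X \<otimes> \<one> X) \<cdot> \<Delta> X \<cdot> p = ((\<Delta> Y \<cdot> f) \<otimes> \<one> X) \<cdot> \<Delta> X \<cdot> p"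
  for C (structure)

definition right_ae_deterministic ::
    "('o, 'a, 'm) quantum_cd_category_scheme \<Rightarrow> 'o \<Rightarrow> 'o \<Rightarrow> 'o \<Rightarrow> 'a \<Rightarrow> 'a \<Rightarrow> bool"
  where "right_ae_deterministic C T X Y p f \<longleftrightarrow>
    p \<in> hom C T X \<and> f \<in> even_hom C X Y \<and>
    (\<one> X \<otimes> (f \<otimes> f)) \<cdot> (\<one> X \<otimes> \<Delta> X) \<cdot> \<Delta> X \<cdot> p = (\<one> X \<otimes> (\<Delta> Y \<cdot> f)) \<cdot> \<Delta> X \<cdot> p"
  for C (structure)

text \<open>
  A triple \<open>(f, p, q)\<close> in the subcategory of even morphisms, with \<open>p\<close> and \<open>q\<close> states and
  \<open>f \<circ> p = q\<close>.
\<close>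

definition state_preserving ::
    "('o, 'a, 'm) quantum_cd_category_scheme \<Rightarrow> 'o \<Rightarrow> 'o \<Rightarrow> 'a \<Rightarrow> 'a \<Rightarrow> 'a \<Rightarrow> bool"
  where "state_preserving C X Y f p q \<longleftrightarrow>
    p \<in> even_hom C \<I> X \<and> q \<in> even_hom C \<I> Y \<and> f \<in> even_hom C X Y \<and> f \<cdot> p = q"
  for C (structure)

definition left_bayes_map ::
    "('o, 'a, 'm) quantum_cd_category_scheme \<Rightarrow> 'o \<Rightarrow> 'o \<Rightarrow> 'a \<Rightarrow> 'a \<Rightarrow> 'a \<Rightarrow> 'a \<Rightarrow> bool"
  where "left_bayes_map C X Y f p q g \<longleftrightarrow>
    state_preserving C X Y f p q \<and> g \<in> even_hom C Y X \<and>
    (g \<otimes> \<one> Y) \<cdot> \<Delta> Y \<cdot> q = (\<one> X \<otimes> f) \<cdot> \<Delta> X \<cdot> p"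
  for C (structure)

definition right_bayes_map ::
    "('o, 'a, 'm) quantum_cd_category_scheme \<Rightarrow> 'o \<Rightarrow> 'o \<Rightarrow> 'a \<Rightarrow> 'a \<Rightarrow> 'a \<Rightarrow> 'a \<Rightarrow> bool"
  where "right_bayes_map C X Y f p q g \<longleftrightarrow>
    state_preserving C X Y f p q \<and> g \<in> even_hom C Y X \<and>
    (\<one> Y \<otimes> g) \<cdot> \<Delta> Y \<cdot> q = (f \<otimes> \<one> X) \<cdot> \<Delta> X \<cdot> p"
  for C (structure)

definition left_disintegration ::
    "('o, 'a, 'm) quantum_cd_category_scheme \<Rightarrow> 'o \<Rightarrow> 'o \<Rightarrow> 'a \<Rightarrow> 'a \<Rightarrow> 'a \<Rightarrow> 'a \<Rightarrow> bool"
  where "left_disintegration C X Y f p q g \<longleftrightarrow>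
    state_preserving C X Y f p q \<and> g \<in> even_hom C Y X \<and>
    g \<cdot> q = p \<and> ((f \<cdot> g) \<otimes> \<one> Y) \<cdot> \<Delta> Y \<cdot> q = \<Delta> Y \<cdot> q"
  for C (structure)

definition right_disintegration ::
    "('o, 'a, 'm) quantum_cd_category_scheme \<Rightarrow> 'o \<Rightarrow> 'o \<Rightarrow> 'a \<Rightarrow> 'a \<Rightarrow> 'a \<Rightarrow> 'a \<Rightarrow> bool"
  where "right_disintegration C X Y f p q g \<longleftrightarrow>
    state_preserving C X Y f p q \<and> g \<in> even_hom C Y X \<and>
    g \<cdot> q = p \<and> (\<one> Y \<otimes> (f \<cdot> g)) \<cdot> \<Delta> Y \<cdot> q = \<Delta> Y \<cdot> q"
  for C (structure)

end

theory Submission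
  imports Defs
begin

text \<open>
  Writing \<open>(h \<otimes> e) \<Delta> x\<close> for a joint state with marginals \<open>h x\<close> and \<open>e x\<close>, each kind of
  almost-everywhere determinism of \<open>f\<close> has \<open>(f \<otimes> f) \<Delta> p = \<Delta> q\<close> as a marginal. A left Bayes map
  \<open>g\<close> has \<open>g q = p\<close> as a marginal of its defining equation, and
  \<open>(f g \<otimes> id) \<Delta> q = (f \<otimes> id)(id \<otimes> f) \<Delta> p = (f \<otimes> f) \<Delta> p = \<Delta> q\<close>. In the
  \<open>*\<close>-preserving case, applying an odd automorphism to each factor and then the symmetry
  exchanges the two factors of such joint states.
\<close>

section \<open>Composition of graded morphisms\<close>

context graded_category
begin

lemma graded_hom_hom: "f \<in> graded_hom C i X Y \<Longrightarrow> f \<in> hom C X Y"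
  by (simp add: graded_hom_def)

lemma graded_hom_src: "f \<in> graded_hom C i X Y \<Longrightarrow> X \<in> obj C"
  using src_obj by (auto simp: graded_hom_def hom_def)

lemma graded_hom_tgt: "f \<in> graded_hom C i X Y \<Longrightarrow> Y \<in> obj C"
  using tgt_obj by (auto simp: graded_hom_def hom_def)

text \<open>Absorbing the summand \<open>0\<close> keeps the grade syntactically equal to
  \<open>i\<close>, so that the result can be passed on by \<open>OF\<close> to rules that expect
  two morphisms of one grade.\<close>

lemma cmp_even_left:
  "\<lbrakk>f \<in> graded_hom C i X Y; g \<in> even_hom C Y Z\<rbrakk> \<Longrightarrow> g \<cdot> f \<in> graded_hom C i X Z"
  using cmp_hom[of f i X Y g 0 Z] by (simp only: add_0_right)

lemma cmp_graded_assoc: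
  "\<lbrakk>f \<in> graded_hom C i W X; g \<in> graded_hom C j X Y; h \<in> graded_hom C k Y Z\<rbrakk>
    \<Longrightarrow> (h \<cdot> g) \<cdot> f = h \<cdot> (g \<cdot> f)"
  by (blast intro: cmp_assoc graded_hom_hom)

lemma cmp_idn_left: "f \<in> graded_hom C i X Y \<Longrightarrow> \<one> Y \<cdot> f = f"
  by (blast intro: idn_left graded_hom_hom)

lemma cmp_idn_right: "f \<in> graded_hom C i X Y \<Longrightarrow> f \<cdot> \<one> X = f"
  by (blast intro: idn_right graded_hom_hom)

end

section \<open>Unitors and the interchange law\<close>

context z2_monoidal_category
begin

lemma right_unitor_hom: "X \<in> obj C \<Longrightarrow> \<r> X \<in> even_hom C (X \<odot> \<I>) X"
  unfolding right_unitor_def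
  by (blast intro: cmp_even_left symmetry_hom left_unitor_hom unit_obj)

lemma left_unitor_natural_even:
  "f \<in> even_hom C X Y \<Longrightarrow> \<l> Y \<cdot> (\<one> \<I> \<otimes> f) = f \<cdot> \<l> X"
  using left_unitor_natural[of f 0 X Y] by (simp add: unit_arr_def)

text \<open>The right unitor is the left unitor after the symmetry, and both are natural. For even
  \<open>f\<close> the action on the unit object is the identity, which gives the shape that the
  marginal computations need.\<close>

lemma right_unitor_natural_even:
  assumes f: "f \<in> even_hom C X Y"
  shows "\<r> Y \<cdot> (f \<otimes> \<one> \<I>) = f \<cdot> \<r> X"
proof -
  note obj = graded_hom_src[OF f] graded_hom_tgt[OF f] unit_obj
  note id = idn_hom[OF unit_obj]
  have "\<r> Y \<cdot> (f \<otimes> \<one> \<I>) = \<l> Y \<cdot> \<gamma> Y \<I> \<cdot> (f \<otimes> \<one> \<I>)"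
    unfolding right_unitor_def
    by (rule cmp_graded_assoc[OF tensor_hom[OF f id] symmetry_hom left_unitor_hom]) (use obj in auto)
  also have "\<dots> = \<l> Y \<cdot> (\<one> \<I> \<otimes> f) \<cdot> \<gamma> X \<I>"
    by (simp add: symmetry_natural[OF f id])
  also have "\<dots> = (\<l> Y \<cdot> (\<one> \<I> \<otimes> f)) \<cdot> \<gamma> X \<I>"
    by (rule cmp_graded_assoc[symmetric, OF symmetry_hom tensor_hom[OF id f] left_unitor_hom])
      (use obj in auto)
  also have "\<dots> = f \<cdot> \<l> X \<cdot> \<gamma> X \<I>"
    unfolding left_unitor_natural_even[OF f]
    by (rule cmp_graded_assoc[OF symmetry_hom left_unitor_hom f]) (use obj in auto)
  finally show ?thesis by (simp add: right_unitor_def)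
qed

text \<open>The trailing \<open>x\<close> makes the interchange law applicable inside right-nested
  composites. The two layers may have different grades, so pairs of stars can be merged with pairs
  of even maps.\<close>

lemma tensor_cmp_cmp:
  assumes "f \<in> graded_hom C i X Y" "f' \<in> graded_hom C i X' Y'"
    and "g \<in> graded_hom C j Y Z" "g' \<in> graded_hom C j Y' Z'"
    and "x \<in> graded_hom C k T (X \<odot> X')"
  shows "(g \<otimes> g') \<cdot> (f \<otimes> f') \<cdot> x = ((g \<cdot> f) \<otimes> (g' \<cdot> f')) \<cdot> x"
  using cmp_graded_assoc[OF assms(5) tensor_hom[OF assms(1,2)] tensor_hom[OF assms(3,4)]]
    tensor_cmp[OF assms(1-4)] by simp

end

section \<open>Stars and the exchange of the two factors of a joint state\<close>

context quantum_cd_category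
begin

lemma copy_cmp: "p \<in> graded_hom C i T X \<Longrightarrow> \<Delta> X \<cdot> p \<in> graded_hom C i T (X \<odot> X)"
  by (blast intro: cmp_even_left copy_hom graded_hom_tgt)

text \<open>\<open>\<star> T\<close> is its own inverse and hence can be cancelled on the right.
  This removes the star that \<open>flip_joint\<close> leaves on the source.\<close>

lemma star_cancel:
  assumes a: "a \<in> graded_hom C i T Z" and b: "b \<in> graded_hom C i T Z"
    and eq: "a \<cdot> \<star> T = b \<cdot> \<star> T"
  shows "a = b"
proof -
  have T: "T \<in> obj C" by (rule graded_hom_src[OF a])
  have inv: "(x \<cdot> \<star> T) \<cdot> \<star> T = x" if x: "x \<in> graded_hom C i T Z" for x
    using cmp_graded_assoc[OF star_hom[OF T] star_hom[OF T] x]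
    by (simp add: star_involution[OF T] cmp_idn_right[OF x])
  show ?thesis using inv[OF a] inv[OF b] eq by metis
qed

text \<open>Moving \<open>k\<close> and \<open>m\<close> through \<open>h\<close> and
  \<open>e\<close> turns them into a pair of stars directly after the copy. The symmetry then
  exchanges \<open>h\<close> and \<open>e\<close> by naturality, \<open>copy_star\<close> trades the
  flipped pair for one star before the copy, and \<open>p_star\<close> moves that star to
  \<open>T\<close>. The odd maps \<open>k\<close> and \<open>m\<close> are left general because
  determinism calls for one on \<open>Y \<odot> Y\<close> that is not its star.\<close>

lemma flip_joint:
  assumes p: "p \<in> graded_hom C i T X" and p_star: "p \<cdot> \<star> T = \<star> X \<cdot> p"
    and h: "h \<in> even_hom C X Z" and k: "k \<in> odd_hom C Z Z" and kh: "k \<cdot> h = h \<cdot> \<star> X"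
    and e: "e \<in> even_hom C X W" and m: "m \<in> odd_hom C W W" and me: "m \<cdot> e = e \<cdot> \<star> X"
  shows "\<gamma> Z W \<cdot> (k \<otimes> m) \<cdot> (h \<otimes> e) \<cdot> \<Delta> X \<cdot> p = ((e \<otimes> h) \<cdot> \<Delta> X \<cdot> p) \<cdot> \<star> T"
proof -
  have X: "X \<in> obj C" and Z: "Z \<in> obj C" and W: "W \<in> obj C" and T: "T \<in> obj C"
    using h e p by (blast intro: graded_hom_src graded_hom_tgt)+
  note s = star_hom[OF X]
  note ss = tensor_hom[OF s s]
  note D = copy_hom[OF X]
  note sD = cmp_hom[OF copy_cmp[OF p] ss]
  have "\<gamma> Z W \<cdot> (k \<otimes> m) \<cdot> (h \<otimes> e) \<cdot> \<Delta> X \<cdot> p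
      = \<gamma> Z W \<cdot> ((h \<cdot> \<star> X) \<otimes> (e \<cdot> \<star> X)) \<cdot> \<Delta> X \<cdot> p"
    by (simp add: tensor_cmp_cmp[OF h e k m copy_cmp[OF p]] kh me)
  also have "\<dots> = \<gamma> Z W \<cdot> (h \<otimes> e) \<cdot> (\<star> X \<otimes> \<star> X) \<cdot> \<Delta> X \<cdot> p"
    by (simp add: tensor_cmp_cmp[OF s s h e copy_cmp[OF p]])
  also have "\<dots> = (\<gamma> Z W \<cdot> (h \<otimes> e)) \<cdot> (\<star> X \<otimes> \<star> X) \<cdot> \<Delta> X \<cdot> p"
    by (rule cmp_graded_assoc[symmetric, OF sD tensor_hom[OF h e] symmetry_hom[OF Z W]])
  also have "\<dots> = (e \<otimes> h) \<cdot> \<gamma> X X \<cdot> (\<star> X \<otimes> \<star> X) \<cdot> \<Delta> X \<cdot> p"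
    unfolding symmetry_natural[OF h e]
    by (rule cmp_graded_assoc[OF sD symmetry_hom[OF X X] tensor_hom[OF e h]])
  also have "\<gamma> X X \<cdot> (\<star> X \<otimes> \<star> X) \<cdot> \<Delta> X \<cdot> p = (\<gamma> X X \<cdot> (\<star> X \<otimes> \<star> X) \<cdot> \<Delta> X) \<cdot> p"
    by (simp add: cmp_graded_assoc[OF p D ss]
        cmp_graded_assoc[OF p cmp_hom[OF D ss] symmetry_hom[OF X X]])
  also have "\<dots> = \<Delta> X \<cdot> p \<cdot> \<star> T"
    by (simp add: copy_star[OF X] cmp_graded_assoc[OF p s D] p_star)
  also have "(e \<otimes> h) \<cdot> \<Delta> X \<cdot> p \<cdot> \<star> T = ((e \<otimes> h) \<cdot> \<Delta> X \<cdot> p) \<cdot> \<star> T"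
    by (simp add: cmp_graded_assoc[OF star_hom[OF T] p D]
        cmp_graded_assoc[OF star_hom[OF T] copy_cmp[OF p] tensor_hom[OF e h]])
  finally show ?thesis .
qed

text \<open>Equal joint states stay equal after the same \<open>k\<close>, \<open>m\<close> and
  symmetry are applied, and \<open>star_cancel\<close> strips the remaining star. The sources
  \<open>X\<close> and \<open>X'\<close> may differ because a Bayes equation compares a copy on
  \<open>Y\<close> with a copy on \<open>X\<close>.\<close>

lemma flip_joint_eq:
  assumes p: "p \<in> graded_hom C i T X" "p \<cdot> \<star> T = \<star> X \<cdot> p"
    and p': "p' \<in> graded_hom C i T X'" "p' \<cdot> \<star> T = \<star> X' \<cdot> p'"
    and k: "k \<in> odd_hom C Z Z" and m: "m \<in> odd_hom C W W"
    and h: "h \<in> even_hom C X Z" "k \<cdot> h = h \<cdot> \<star> X"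
    and e: "e \<in> even_hom C X W" "m \<cdot> e = e \<cdot> \<star> X"
    and h': "h' \<in> even_hom C X' Z" "k \<cdot> h' = h' \<cdot> \<star> X'"
    and e': "e' \<in> even_hom C X' W" "m \<cdot> e' = e' \<cdot> \<star> X'"
  shows "(h \<otimes> e) \<cdot> \<Delta> X \<cdot> p = (h' \<otimes> e') \<cdot> \<Delta> X' \<cdot> p' \<longleftrightarrow>
    (e \<otimes> h) \<cdot> \<Delta> X \<cdot> p = (e' \<otimes> h') \<cdot> \<Delta> X' \<cdot> p'"
proof
  assume "(h \<otimes> e) \<cdot> \<Delta> X \<cdot> p = (h' \<otimes> e') \<cdot> \<Delta> X' \<cdot> p'"
  with flip_joint[OF p h(1) k h(2) e(1) m e(2)] flip_joint[OF p' h'(1) k h'(2) e'(1) m e'(2)]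
  show "(e \<otimes> h) \<cdot> \<Delta> X \<cdot> p = (e' \<otimes> h') \<cdot> \<Delta> X' \<cdot> p'"
    by (intro star_cancel[OF cmp_even_left[OF copy_cmp[OF p(1)] tensor_hom[OF e(1) h(1)]]
          cmp_even_left[OF copy_cmp[OF p'(1)] tensor_hom[OF e'(1) h'(1)]]]) simp
next
  \<comment> \<open>The converse is the same argument with the pairs \<open>h\<close>,
    \<open>k\<close> and \<open>e\<close>, \<open>m\<close> interchanged.\<close>
  assume "(e \<otimes> h) \<cdot> \<Delta> X \<cdot> p = (e' \<otimes> h') \<cdot> \<Delta> X' \<cdot> p'"
  with flip_joint[OF p e(1) m e(2) h(1) k h(2)] flip_joint[OF p' e'(1) m e'(2) h'(1) k h'(2)]
  show "(h \<otimes> e) \<cdot> \<Delta> X \<cdot> p = (h' \<otimes> e') \<cdot> \<Delta> X' \<cdot> p'"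
    by (intro star_cancel[OF cmp_even_left[OF copy_cmp[OF p(1)] tensor_hom[OF h(1) e(1)]]
          cmp_even_left[OF copy_cmp[OF p'(1)] tensor_hom[OF h'(1) e'(1)]]]) simp
qed

lemma star_idn: "X \<in> obj C \<Longrightarrow> \<star> X \<cdot> \<one> X = \<one> X \<cdot> \<star> X"
  using cmp_idn_left[OF star_hom] cmp_idn_right[OF star_hom] by simp

lemma star_cmp:
  assumes a: "a \<in> graded_hom C i X Y" "a \<cdot> \<star> X = \<star> Y \<cdot> a"
    and b: "b \<in> graded_hom C j Y Z" "b \<cdot> \<star> Y = \<star> Z \<cdot> b"
  shows "(b \<cdot> a) \<cdot> \<star> X = \<star> Z \<cdot> b \<cdot> a"
proof -
  have X: "X \<in> obj C" and Y: "Y \<in> obj C" and Z: "Z \<in> obj C"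
    using a(1) b(1) by (blast intro: graded_hom_src graded_hom_tgt)+
  show ?thesis
    using cmp_graded_assoc[OF star_hom[OF X] a(1) b(1)]
      cmp_graded_assoc[OF a(1) star_hom[OF Y] b(1)]
      cmp_graded_assoc[OF a(1) b(1) star_hom[OF Z]]
    by (simp add: a(2) b(2))
qed

text \<open>
  Since \<open>\<Delta>\<close> intertwines \<open>*\<close> with \<open>\<gamma> (* \<otimes> *)\<close> and not with the star of the tensor square, the
  two sides of almost-everywhere determinism are equivariant only for this other odd map.
\<close>

lemma flip_copy:
  assumes f: "f \<in> even_hom C X Y" and f_star: "f \<cdot> \<star> X = \<star> Y \<cdot> f"
  shows "(\<gamma> Y Y \<cdot> (\<star> Y \<otimes> \<star> Y)) \<cdot> (\<Delta> Y \<cdot> f) = (\<Delta> Y \<cdot> f) \<cdot> \<star> X"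
    and "(\<gamma> Y Y \<cdot> (\<star> Y \<otimes> \<star> Y)) \<cdot> ((f \<otimes> f) \<cdot> \<Delta> X) = ((f \<otimes> f) \<cdot> \<Delta> X) \<cdot> \<star> X"
proof -
  have X: "X \<in> obj C" and Y: "Y \<in> obj C"
    using f by (blast intro: graded_hom_src graded_hom_tgt)+
  note DX = copy_hom[OF X] and DY = copy_hom[OF Y]
  note sX = star_hom[OF X] and sY = star_hom[OF Y]
  note ssX = tensor_hom[OF sX sX] and ssY = tensor_hom[OF sY sY]
  note gX = symmetry_hom[OF X X] and gY = symmetry_hom[OF Y Y]
  note ff = tensor_hom[OF f f]
  have "(\<gamma> Y Y \<cdot> (\<star> Y \<otimes> \<star> Y)) \<cdot> (\<Delta> Y \<cdot> f) = ((\<gamma> Y Y \<cdot> (\<star> Y \<otimes> \<star> Y)) \<cdot> \<Delta> Y) \<cdot> f"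
    by (rule cmp_graded_assoc[symmetric, OF f DY cmp_even_left[OF ssY gY]])
  also have "(\<gamma> Y Y \<cdot> (\<star> Y \<otimes> \<star> Y)) \<cdot> \<Delta> Y = \<Delta> Y \<cdot> \<star> Y"
    using cmp_graded_assoc[OF DY ssY gY] copy_star[OF Y] by simp
  also have "(\<Delta> Y \<cdot> \<star> Y) \<cdot> f = (\<Delta> Y \<cdot> f) \<cdot> \<star> X"
    by (simp add: cmp_graded_assoc[OF f sY DY] cmp_graded_assoc[OF sX f DY] f_star)
  finally show "(\<gamma> Y Y \<cdot> (\<star> Y \<otimes> \<star> Y)) \<cdot> (\<Delta> Y \<cdot> f) = (\<Delta> Y \<cdot> f) \<cdot> \<star> X" .
  have "(\<gamma> Y Y \<cdot> (\<star> Y \<otimes> \<star> Y)) \<cdot> ((f \<otimes> f) \<cdot> \<Delta> X)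
      = \<gamma> Y Y \<cdot> (\<star> Y \<otimes> \<star> Y) \<cdot> (f \<otimes> f) \<cdot> \<Delta> X"
    by (rule cmp_graded_assoc[OF cmp_even_left[OF DX ff] ssY gY])
  \<comment> \<open>Both sides merge to one tensor by interchange, and \<open>f_star\<close>
    identifies the factors.\<close>
  also have "\<dots> = \<gamma> Y Y \<cdot> (f \<otimes> f) \<cdot> (\<star> X \<otimes> \<star> X) \<cdot> \<Delta> X"
    by (simp add: tensor_cmp_cmp[OF f f sY sY DX] tensor_cmp_cmp[OF sX sX f f DX] f_star)
  also have "\<dots> = (f \<otimes> f) \<cdot> \<gamma> X X \<cdot> (\<star> X \<otimes> \<star> X) \<cdot> \<Delta> X"
    using cmp_graded_assoc[OF cmp_hom[OF DX ssX] ff gY]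
      cmp_graded_assoc[OF cmp_hom[OF DX ssX] gX ff] symmetry_natural[OF f f] by simp
  also have "\<dots> = ((f \<otimes> f) \<cdot> \<Delta> X) \<cdot> \<star> X"
    by (simp add: copy_star[OF X] cmp_graded_assoc[OF sX DX ff])
  finally show "(\<gamma> Y Y \<cdot> (\<star> Y \<otimes> \<star> Y)) \<cdot> ((f \<otimes> f) \<cdot> \<Delta> X) = ((f \<otimes> f) \<cdot> \<Delta> X) \<cdot> \<star> X" .
qed

section \<open>Equivalence of the left and right notions under star preservation\<close>

text \<open>Merging the two tensor layers brings both sides into the form
  \<open>(h \<otimes> e) \<cdot> \<Delta> X \<cdot> p\<close> with \<open>e\<close> the identity,
  the form to which the flip and marginal lemmas apply.\<close>

lemma left_ae_deterministic_iff:
  assumes p: "p \<in> even_hom C T X" and f: "f \<in> even_hom C X Y"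
  shows "left_ae_deterministic C T X Y p f \<longleftrightarrow>
    (((f \<otimes> f) \<cdot> \<Delta> X) \<otimes> \<one> X) \<cdot> \<Delta> X \<cdot> p = ((\<Delta> Y \<cdot> f) \<otimes> \<one> X) \<cdot> \<Delta> X \<cdot> p"
proof -
  have X: "X \<in> obj C" using f by (rule graded_hom_src)
  note id = idn_hom[OF X]
  show ?thesis
    using tensor_cmp_cmp[OF copy_hom[OF X] id tensor_hom[OF f f] id copy_cmp[OF p]] p f
    by (simp add: left_ae_deterministic_def graded_hom_hom cmp_idn_left[OF id])
qed

lemma right_ae_deterministic_iff:
  assumes p: "p \<in> even_hom C T X" and f: "f \<in> even_hom C X Y"
  shows "right_ae_deterministic C T X Y p f \<longleftrightarrow>
    (\<one> X \<otimes> ((f \<otimes> f) \<cdot> \<Delta> X)) \<cdot> \<Delta> X \<cdot> p = (\<one> X \<otimes> (\<Delta> Y \<cdot> f)) \<cdot> \<Delta> X \<cdot> p"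
proof -
  have X: "X \<in> obj C" using f by (rule graded_hom_src)
  note id = idn_hom[OF X]
  show ?thesis
    using tensor_cmp_cmp[OF id copy_hom[OF X] id tensor_hom[OF f f] copy_cmp[OF p]] p f
    by (simp add: right_ae_deterministic_def graded_hom_hom cmp_idn_left[OF id])
qed

lemma star_preserving_ae_deterministic_iff:
  assumes p: "p \<in> even_hom C T X" "p \<cdot> \<star> T = \<star> X \<cdot> p"
    and f: "f \<in> even_hom C X Y" "f \<cdot> \<star> X = \<star> Y \<cdot> f"
  shows "left_ae_deterministic C T X Y p f \<longleftrightarrow> right_ae_deterministic C T X Y p f"
proof -
  have X: "X \<in> obj C" and Y: "Y \<in> obj C"
    using f(1) by (blast intro: graded_hom_src graded_hom_tgt)+
  show ?thesis
    unfolding left_ae_deterministic_iff[OF p(1) f(1)] right_ae_deterministic_iff[OF p(1) f(1)]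
    \<comment> \<open>Here \<open>k\<close> is the symmetry after
      \<open>\<star> Y \<otimes> \<star> Y\<close>, for which \<open>flip_copy\<close> supplies
      equivariance of both sides; \<open>m\<close> is \<open>\<star> X\<close>.\<close>
    by (rule flip_joint_eq[OF p p
          cmp_even_left[OF tensor_hom[OF star_hom[OF Y] star_hom[OF Y]] symmetry_hom[OF Y Y]]
          star_hom[OF X] cmp_even_left[OF copy_hom[OF X] tensor_hom[OF f(1) f(1)]]
          flip_copy(2)[OF f] idn_hom[OF X] star_idn[OF X] copy_cmp[OF f(1)] flip_copy(1)[OF f]
          idn_hom[OF X] star_idn[OF X]])
qed

lemma star_preserving_bayes_map_iff:
  assumes p: "p \<in> even_hom C \<I> X" "p \<cdot> \<star> \<I> = \<star> X \<cdot> p"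
    and f: "f \<in> even_hom C X Y" "f \<cdot> \<star> X = \<star> Y \<cdot> f"
    and g: "g \<cdot> \<star> Y = \<star> X \<cdot> g"
  shows "left_bayes_map C X Y f p (f \<cdot> p) g \<longleftrightarrow> right_bayes_map C X Y f p (f \<cdot> p) g"
proof -
  have X: "X \<in> obj C" and Y: "Y \<in> obj C"
    using f(1) by (blast intro: graded_hom_src graded_hom_tgt)+
  note q = cmp_even_left[OF p(1) f(1)] star_cmp[OF p f]
  show ?thesis
    unfolding left_bayes_map_def right_bayes_map_def
    \<comment> \<open>Flipping the left Bayes equation gives the right one. The open premise is that
      \<open>g\<close> is even, which either Bayes condition provides.\<close>
    using flip_joint_eq[OF q p star_hom[OF X] star_hom[OF Y] _ g[symmetric] idn_hom[OF Y]
        star_idn[OF Y] idn_hom[OF X] star_idn[OF X] f(1) f(2)[symmetric]]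
    by blast
qed

lemma star_preserving_disintegration_iff:
  assumes p: "p \<in> even_hom C \<I> X" "p \<cdot> \<star> \<I> = \<star> X \<cdot> p"
    and f: "f \<in> even_hom C X Y" "f \<cdot> \<star> X = \<star> Y \<cdot> f"
    and g: "g \<cdot> \<star> Y = \<star> X \<cdot> g"
  shows "left_disintegration C X Y f p (f \<cdot> p) g \<longleftrightarrow> right_disintegration C X Y f p (f \<cdot> p) g"
proof -
  have Y: "Y \<in> obj C" by (rule graded_hom_tgt[OF f(1)])
  note id = idn_hom[OF Y]
  note q = cmp_even_left[OF p(1) f(1)] star_cmp[OF p f]
  \<comment> \<open>This presents the bare copy of the state as a joint state with equal factors,
    which the flip leaves in the same form.\<close>
  have id_joint: "(\<one> Y \<otimes> \<one> Y) \<cdot> \<Delta> Y \<cdot> f \<cdot> p = \<Delta> Y \<cdot> f \<cdot> p"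
    using cmp_idn_left[OF copy_cmp[OF q(1)]] by (simp add: tensor_idn[OF Y Y])
  have "((f \<cdot> g) \<otimes> \<one> Y) \<cdot> \<Delta> Y \<cdot> f \<cdot> p = \<Delta> Y \<cdot> f \<cdot> p \<longleftrightarrow>
      (\<one> Y \<otimes> (f \<cdot> g)) \<cdot> \<Delta> Y \<cdot> f \<cdot> p = \<Delta> Y \<cdot> f \<cdot> p" if "g \<in> even_hom C Y X"
    using flip_joint_eq[OF q q star_hom[OF Y] star_hom[OF Y] cmp_even_left[OF that f(1)]
        star_cmp[OF that g f, symmetric] id star_idn[OF Y] id star_idn[OF Y] id star_idn[OF Y]]
    by (simp add: id_joint)
  then show ?thesis
    unfolding left_disintegration_def right_disintegration_def by blast
qed

end

section \<open>Marginals and disintegrations\<close>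

context quantum_markov_category
begin

text \<open>Discarding after \<open>e\<close> is discarding on \<open>X\<close>, by the Markov
  condition on even morphisms. Naturality of the right unitor then pulls \<open>h\<close> out, and
  the counit law \<open>discard_right\<close> removes the copy.\<close>

lemma left_marginal:
  assumes p: "p \<in> graded_hom C i T X" and h: "h \<in> even_hom C X Z" and e: "e \<in> even_hom C X W"
  shows "\<r> Z \<cdot> (\<one> Z \<otimes> \<epsilon> W) \<cdot> (h \<otimes> e) \<cdot> \<Delta> X \<cdot> p = h \<cdot> p"
proof -
  have X: "X \<in> obj C" and Z: "Z \<in> obj C" and W: "W \<in> obj C"
    using h e by (blast intro: graded_hom_src graded_hom_tgt)+
  note idX = idn_hom[OF X] and idZ = idn_hom[OF Z] and idI = idn_hom[OF unit_obj]
  note d = discard_hom[OF X] and D = copy_hom[OF X] and Dp = copy_cmp[OF p]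
  note rX = right_unitor_hom[OF X]
  note dD = cmp_even_left[OF Dp tensor_hom[OF idX d]]
  have "(\<one> Z \<otimes> \<epsilon> W) \<cdot> (h \<otimes> e) \<cdot> \<Delta> X \<cdot> p = (h \<otimes> \<epsilon> X) \<cdot> \<Delta> X \<cdot> p"
    by (simp add: tensor_cmp_cmp[OF h e idZ discard_hom[OF W] Dp] cmp_idn_left[OF h]
        discard_even[OF e])
  also have "\<dots> = (h \<otimes> \<one> \<I>) \<cdot> (\<one> X \<otimes> \<epsilon> X) \<cdot> \<Delta> X \<cdot> p"
    by (simp add: tensor_cmp_cmp[OF idX d h idI Dp] cmp_idn_right[OF h] cmp_idn_left[OF d])
  finally have "\<r> Z \<cdot> (\<one> Z \<otimes> \<epsilon> W) \<cdot> (h \<otimes> e) \<cdot> \<Delta> X \<cdot> p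
      = \<r> Z \<cdot> (h \<otimes> \<one> \<I>) \<cdot> (\<one> X \<otimes> \<epsilon> X) \<cdot> \<Delta> X \<cdot> p"
    by simp
  also have "\<dots> = h \<cdot> \<r> X \<cdot> (\<one> X \<otimes> \<epsilon> X) \<cdot> \<Delta> X \<cdot> p"
    using cmp_graded_assoc[OF dD tensor_hom[OF h idI] right_unitor_hom[OF Z]]
      cmp_graded_assoc[OF dD rX h] right_unitor_natural_even[OF h]
    by metis
  also have "\<dots> = h \<cdot> (\<r> X \<cdot> (\<one> X \<otimes> \<epsilon> X) \<cdot> \<Delta> X) \<cdot> p"
    by (simp add: cmp_graded_assoc[OF p D tensor_hom[OF idX d]]
        cmp_graded_assoc[OF p cmp_even_left[OF D tensor_hom[OF idX d]] rX])
  finally show ?thesis by (simp add: discard_right[OF X] cmp_idn_left[OF p])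
qed

text \<open>Copying need not be commutative, so the mirror argument is carried out with the left
  unitor and \<open>discard_left\<close> instead of swapping factors in
  \<open>left_marginal\<close>.\<close>

lemma right_marginal:
  assumes p: "p \<in> graded_hom C i T X" and h: "h \<in> even_hom C X Z" and e: "e \<in> even_hom C X W"
  shows "\<l> Z \<cdot> (\<epsilon> W \<otimes> \<one> Z) \<cdot> (e \<otimes> h) \<cdot> \<Delta> X \<cdot> p = h \<cdot> p"
proof -
  have X: "X \<in> obj C" and Z: "Z \<in> obj C" and W: "W \<in> obj C"
    using h e by (blast intro: graded_hom_src graded_hom_tgt)+
  note idX = idn_hom[OF X] and idZ = idn_hom[OF Z] and idI = idn_hom[OF unit_obj]
  note d = discard_hom[OF X] and D = copy_hom[OF X] and Dp = copy_cmp[OF p]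
  note lX = left_unitor_hom[OF X]
  note dD = cmp_even_left[OF Dp tensor_hom[OF d idX]]
  have "(\<epsilon> W \<otimes> \<one> Z) \<cdot> (e \<otimes> h) \<cdot> \<Delta> X \<cdot> p = (\<epsilon> X \<otimes> h) \<cdot> \<Delta> X \<cdot> p"
    by (simp add: tensor_cmp_cmp[OF e h discard_hom[OF W] idZ Dp] cmp_idn_left[OF h]
        discard_even[OF e])
  also have "\<dots> = (\<one> \<I> \<otimes> h) \<cdot> (\<epsilon> X \<otimes> \<one> X) \<cdot> \<Delta> X \<cdot> p"
    by (simp add: tensor_cmp_cmp[OF d idX idI h Dp] cmp_idn_right[OF h] cmp_idn_left[OF d])
  finally have "\<l> Z \<cdot> (\<epsilon> W \<otimes> \<one> Z) \<cdot> (e \<otimes> h) \<cdot> \<Delta> X \<cdot> p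
      = \<l> Z \<cdot> (\<one> \<I> \<otimes> h) \<cdot> (\<epsilon> X \<otimes> \<one> X) \<cdot> \<Delta> X \<cdot> p"
    by simp
  also have "\<dots> = h \<cdot> \<l> X \<cdot> (\<epsilon> X \<otimes> \<one> X) \<cdot> \<Delta> X \<cdot> p"
    using cmp_graded_assoc[OF dD tensor_hom[OF idI h] left_unitor_hom[OF Z]]
      cmp_graded_assoc[OF dD lX h] left_unitor_natural_even[OF h]
    by metis
  also have "\<dots> = h \<cdot> (\<l> X \<cdot> (\<epsilon> X \<otimes> \<one> X) \<cdot> \<Delta> X) \<cdot> p"
    by (simp add: cmp_graded_assoc[OF p D tensor_hom[OF d idX]]
        cmp_graded_assoc[OF p cmp_even_left[OF D tensor_hom[OF d idX]] lX])
  finally show ?thesis by (simp add: discard_left[OF X] cmp_idn_left[OF p])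
qed

text \<open>Discarding the factor that carries the identity on \<open>X\<close> yields the same
  equation from either kind of determinism. Hence its side need not match the side of the Bayes
  map.\<close>

lemma ae_deterministic_copy:
  assumes p: "p \<in> even_hom C T X" and f: "f \<in> even_hom C X Y"
    and det: "left_ae_deterministic C T X Y p f \<or> right_ae_deterministic C T X Y p f"
  shows "(f \<otimes> f) \<cdot> \<Delta> X \<cdot> p = \<Delta> Y \<cdot> f \<cdot> p"
proof -
  have X: "X \<in> obj C" and Y: "Y \<in> obj C"
    using f by (blast intro: graded_hom_src graded_hom_tgt)+
  note id = idn_hom[OF X]
  note ffD = cmp_even_left[OF copy_hom[OF X] tensor_hom[OF f f]] and Df = copy_cmp[OF f]
  have "((f \<otimes> f) \<cdot> \<Delta> X) \<cdot> p = (\<Delta> Y \<cdot> f) \<cdot> p"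
    using det left_marginal[OF p ffD id] left_marginal[OF p Df id]
      right_marginal[OF p ffD id] right_marginal[OF p Df id]
    by (auto simp: left_ae_deterministic_iff[OF p f] right_ae_deterministic_iff[OF p f])
  then show ?thesis
    by (simp add: cmp_graded_assoc[OF p copy_hom[OF X] tensor_hom[OF f f]]
        cmp_graded_assoc[OF p f copy_hom[OF Y]])
qed

lemma left_bayes_map_disintegration:
  assumes bayes: "left_bayes_map C X Y f p q g" and copy: "(f \<otimes> f) \<cdot> \<Delta> X \<cdot> p = \<Delta> Y \<cdot> q"
  shows "left_disintegration C X Y f p q g"
proof -
  have state: "state_preserving C X Y f p q" and g: "g \<in> even_hom C Y X"
    and eq: "(g \<otimes> \<one> Y) \<cdot> \<Delta> Y \<cdot> q = (\<one> X \<otimes> f) \<cdot> \<Delta> X \<cdot> p"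
    using bayes by (auto simp: left_bayes_map_def)
  have p: "p \<in> even_hom C \<I> X" and q: "q \<in> even_hom C \<I> Y" and f: "f \<in> even_hom C X Y"
    using state by (auto simp: state_preserving_def)
  have idX: "\<one> X \<in> even_hom C X X" and idY: "\<one> Y \<in> even_hom C Y Y"
    using f by (blast intro: idn_hom graded_hom_src graded_hom_tgt)+
  \<comment> \<open>Discarding the factor \<open>Y\<close> in the Bayes equation leaves
    \<open>g \<cdot> q\<close> on one side and \<open>\<one> X \<cdot> p\<close> on the
    other.\<close>
  have "g \<cdot> q = p"
    using left_marginal[OF q g idY] left_marginal[OF p idX f] cmp_idn_left[OF p] eq by simp
  moreover have "((f \<cdot> g) \<otimes> \<one> Y) \<cdot> \<Delta> Y \<cdot> q = (f \<otimes> \<one> Y) \<cdot> (g \<otimes> \<one> Y) \<cdot> \<Delta> Y \<cdot> q"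
    by (simp add: tensor_cmp_cmp[OF g idY f idY copy_cmp[OF q]] cmp_idn_left[OF idY])
  moreover have "\<dots> = (f \<otimes> f) \<cdot> \<Delta> X \<cdot> p"
    by (simp add: eq tensor_cmp_cmp[OF idX f f idY copy_cmp[OF p]] cmp_idn_left[OF f]
        cmp_idn_right[OF f])
  ultimately show ?thesis
    using state g copy by (simp add: left_disintegration_def)
qed

lemma right_bayes_map_disintegration:
  assumes bayes: "right_bayes_map C X Y f p q g" and copy: "(f \<otimes> f) \<cdot> \<Delta> X \<cdot> p = \<Delta> Y \<cdot> q"
  shows "right_disintegration C X Y f p q g"
proof -
  have state: "state_preserving C X Y f p q" and g: "g \<in> even_hom C Y X"
    and eq: "(\<one> Y \<otimes> g) \<cdot> \<Delta> Y \<cdot> q = (f \<otimes> \<one> X) \<cdot> \<Delta> X \<cdot> p"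
    using bayes by (auto simp: right_bayes_map_def)
  have p: "p \<in> even_hom C \<I> X" and q: "q \<in> even_hom C \<I> Y" and f: "f \<in> even_hom C X Y"
    using state by (auto simp: state_preserving_def)
  have idX: "\<one> X \<in> even_hom C X X" and idY: "\<one> Y \<in> even_hom C Y Y"
    using f by (blast intro: idn_hom graded_hom_src graded_hom_tgt)+
  \<comment> \<open>The factor \<open>Y\<close> now stands on the left, so the right marginals are
    compared.\<close>
  have "g \<cdot> q = p"
    using right_marginal[OF q g idY] right_marginal[OF p idX f] cmp_idn_left[OF p] eq by simp
  moreover have "(\<one> Y \<otimes> (f \<cdot> g)) \<cdot> \<Delta> Y \<cdot> q = (\<one> Y \<otimes> f) \<cdot> (\<one> Y \<otimes> g) \<cdot> \<Delta> Y \<cdot> q"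
    by (simp add: tensor_cmp_cmp[OF idY g idY f copy_cmp[OF q]] cmp_idn_left[OF idY])
  moreover have "\<dots> = (f \<otimes> f) \<cdot> \<Delta> X \<cdot> p"
    by (simp add: eq tensor_cmp_cmp[OF f idX idY f copy_cmp[OF p]] cmp_idn_left[OF f]
        cmp_idn_right[OF f])
  ultimately show ?thesis
    using state g copy by (simp add: right_disintegration_def)
qed

end

section \<open>From Bayes maps to disintegrations\<close>

theorem proposition7p31:
  fixes C :: "('o, 'a, 'm) quantum_cd_category_scheme" (structure)
    and X Y :: 'o and p f q :: 'a
  assumes "quantum_markov_category C"
    and "p \<in> even_hom C \<I> X"
    and "f \<in> even_hom C X Y"
    and "q = f \<cdot> p"
  shows
    "(left_ae_deterministic C \<I> X Y p f \<or> right_ae_deterministic C \<I> X Y p f \<longrightarrow>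
       (\<forall>g. left_bayes_map C X Y f p q g \<longrightarrow> left_disintegration C X Y f p q g) \<and>
       (\<forall>g. right_bayes_map C X Y f p q g \<longrightarrow> right_disintegration C X Y f p q g)) \<and>
     (star_preserving C \<I> X p \<and> star_preserving C X Y f \<longrightarrow>
       (left_ae_deterministic C \<I> X Y p f \<longleftrightarrow> right_ae_deterministic C \<I> X Y p f) \<and>
       (\<forall>g. star_preserving C Y X g \<longrightarrow>
         (left_bayes_map C X Y f p q g \<longleftrightarrow> right_bayes_map C X Y f p q g) \<and>
         (left_disintegration C X Y f p q g \<longleftrightarrow> right_disintegration C X Y f p q g) \<and>
         ((left_ae_deterministic C \<I> X Y p f \<or> right_ae_deterministic C \<I> X Y p f) \<and>
          (left_bayes_map C X Y f p q g \<or> right_bayes_map C X Y f p q g) \<longrightarrow>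
            left_disintegration C X Y f p q g \<and> right_disintegration C X Y f p q g)))"
proof -
  interpret quantum_markov_category C by (rule assms(1))
  let ?det = "left_ae_deterministic C \<I> X Y p f \<or> right_ae_deterministic C \<I> X Y p f"
  have left: "left_disintegration C X Y f p q g"
    if "?det" "left_bayes_map C X Y f p q g" for g
    using left_bayes_map_disintegration ae_deterministic_copy[OF assms(2,3)] that assms(4)
    by metis
  have right: "right_disintegration C X Y f p q g"
    if "?det" "right_bayes_map C X Y f p q g" for g
    using right_bayes_map_disintegration ae_deterministic_copy[OF assms(2,3)] that assms(4)
    by metis
  have "(left_ae_deterministic C \<I> X Y p f \<longleftrightarrow> right_ae_deterministic C \<I> X Y p f) \<and>
      (\<forall>g. star_preserving C Y X g \<longrightarrow>
        (left_bayes_map C X Y f p q g \<longleftrightarrow> right_bayes_map C X Y f p q g) \<and>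
        (left_disintegration C X Y f p q g \<longleftrightarrow> right_disintegration C X Y f p q g))"
    if "star_preserving C \<I> X p \<and> star_preserving C X Y f"
  proof -
    have p: "p \<cdot> \<star> \<I> = \<star> X \<cdot> p" and f: "f \<cdot> \<star> X = \<star> Y \<cdot> f"
      using that by (auto simp: star_preserving_def)
    show ?thesis
      unfolding assms(4)
      using star_preserving_ae_deterministic_iff[OF assms(2) p assms(3) f]
        star_preserving_bayes_map_iff[OF assms(2) p assms(3) f]
        star_preserving_disintegration_iff[OF assms(2) p assms(3) f]
      by (auto simp: star_preserving_def)
  qed
  \<comment> \<open>A Bayes map of either side gives the disintegration of its own side by
    \<open>left\<close> or \<open>right\<close>, and the equivalence then gives the other
    side.\<close>
  with left right show ?thesis by blast
qed

end
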